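(* Let $N\in\mathbb{N}\setminus\{0,1\}$, $s\in(0,1)$ and $p\in[1,\infty)$. There exists a constant $C$ depending only on $N$, $s$ and $p$ such that for all measurable functions $u\colon\mathbb{R}^N_+\to\mathbb{R}$ and $v\colon\partial\mathbb{R}^N_+\to\mathbb{R}$, $$\int_{\mathbb{R}^N_+}\frac{|v(x')-u(x)|^p}{x_N^{sp+1}}\,\mathrm{d}x \le C\int_{\partial\mathbb{R}^N_+}\Bigl(\int_{\mathbb{R}^N_+}\frac{|v(x)-u(y)|^p}{|x-y|^{N+sp}}\,\mathrm{d}y\Bigr)\mathrm{d}x .$$
   Context: $\mathbb{R}^N_+ = \mathbb{R}^{N-1}\times(0,\infty)$, with points written $x=(x',x_N)$, $x'\in\mathbb{R}^{N-1}$, $x_N>0$. Its boundary $\partial\mathbb{R}^N_+ = \mathbb{R}^{N-1}\times\{0\}$ is identified with $\mathbb{R}^{N-1}$ (so that $v(x')$ means $v(x',0)$) and carries the $(N-1)$-dimensional Lebesgue measure; $|x-y|$ is the Euclidean distance in $\mathbb{R}^N$. Integrals of nonnegative functions take values in $[0,\infty]$. *)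

theory Defs
  imports "HOL-Analysis.Analysis"
begin

text \<open>
  For \<open>N = CARD('n) + 1\<close>, the space \<open>\<real>\<^sup>N\<close> is modelled as \<open>(real^'n) \<times> real\<close>: a point
  is \<open>x = (x', x\<^sub>N)\<close> with \<open>x' = fst x\<close> and \<open>x\<^sub>N = snd x\<close>, and the library's product norm
  and Lebesgue measure are the Euclidean norm and the \<open>N\<close>-dimensional Lebesgue measure.  Finite
  index types are nonempty, so \<open>N\<close> ranges over exactly the integers \<open>N \<ge> 2\<close>.
\<close>

definition half_space :: "((real^'n) \<times> real) set" where
  "half_space = {x. 0 < snd x}"

text \<open>The identification of \<open>\<real>\<^sup>N\<^sup>-\<^sup>1\<close> with the boundary of the half-space.\<close>

definition bdry_point :: "real^'n \<Rightarrow> (real^'n) \<times> real" where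
  "bdry_point x' = (x', 0)"

end

theory Submission
  imports Defs
begin

text \<open>
  Write a point of the half-space as \<open>X = (x, t)\<close> and let \<open>q = N + s p\<close>, so that the weight on the
  left is \<open>t powr (N - 1 - q)\<close>. The idea is to compare \<open>v x\<close> with \<open>u X\<close> along a chain
  \<open>v x \<rightarrow> u y \<rightarrow> v z \<rightarrow> u X\<close> in which every link joins a boundary point to an interior point, since only
  such differences occur on the right. The intermediate points are averaged at the scale \<open>t\<close> that the
  point \<open>X\<close> prescribes: \<open>z\<close> over the boundary ball \<open>B = ball x t\<close> and \<open>y\<close> over the cylinder
  \<open>B \<times> {0<..<t}\<close>, whose measures are \<open>c * t ^ (N - 1)\<close> and \<open>c * t ^ N\<close>, where \<open>c\<close> is the volume of the
  unit ball (lemma \<open>pointwise_average\<close>).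

  Integrate the result over \<open>x\<close> and \<open>t\<close>. In the last link the interior point is \<open>X\<close> itself, whose
  distance from the boundary points \<open>z\<close> of \<open>B\<close> is less than \<open>2 * t\<close>, so the weight, once divided
  by the measure of \<open>B\<close>, is at most a multiple of the kernel \<open>norm ((z, 0) - X) powr - q\<close>. In the two other links, \<open>t\<close> is not tied to the
  two points in the difference. Only a lower bound remains: their distance is less than \<open>2 * t\<close>
  respectively \<open>3 * t\<close>. Tonelli's theorem lets the integral over \<open>t\<close> be done first, and the kernel
  arises as the tail \<open>\<integral> t powr - (q + 1)\<close> over these scales (lemma \<open>nn_integral_admissible_scales\<close>).
  In the middle link the base point \<open>x\<close> is integrated out as well; it ranges over a ball of radius
  \<open>t\<close> about \<open>z\<close>, which cancels the division by the measure of \<open>B\<close>.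

  The expression \<open>\<bar>v z - u y\<bar> powr p\<close> enters through a quasi-triangle inequality along the chain, so the
  links are estimated for a nonnegative Borel kernel \<open>G z y\<close> in its place. Lebesgue measurable \<open>u\<close> and \<open>v\<close> are
  replaced by Borel functions that agree with them almost everywhere; neither side changes.
\<close>

section \<open>Integration on products and over scales\<close>

lemma nn_integral_powr_tail:
  fixes b q :: real
  assumes "0 < b" "0 < q"
  shows "(\<integral>\<^sup>+ t. of_bool (b < t) * ennreal (t powr - (q + 1)) \<partial>lborel) = ennreal (b powr - q / q)"
proof -
  have "(\<integral>\<^sup>+ t. ennreal (t powr - (q + 1)) * indicator {b..} t \<partial>lborel)
      = 0 - (- (b powr - q / q))"
  proof (rule nn_integral_FTC_atLeast[where F = "\<lambda>t. - (t powr - q / q)"])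
    show "(\<lambda>t. t powr - (q + 1)) \<in> borel_measurable borel" by measurable
    show "((\<lambda>t. - (t powr - q / q)) has_real_derivative t powr - (q + 1)) (at t)" if "b \<le> t" for t
      using assms that by (auto intro!: derivative_eq_intros simp: diff_conv_add_uminus[symmetric])
    have "((\<lambda>t. - (t powr - q / q)) \<longlongrightarrow> - (0 / q)) at_top"
      using assms by (intro tendsto_intros tendsto_neg_powr filterlim_ident) auto
    then show "((\<lambda>t. - (t powr - q / q)) \<longlongrightarrow> 0) at_top" by simp
  qed auto
  moreover have "(\<integral>\<^sup>+ t. of_bool (b < t) * ennreal (t powr - (q + 1)) \<partial>lborel)
      = (\<integral>\<^sup>+ t. ennreal (t powr - (q + 1)) * indicator {b..} t \<partial>lborel)"
    by (rule nn_integral_cong_AE, rule eventually_mono[OF AE_lborel_singleton[of b]])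
       (auto simp: indicator_def)
  ultimately show ?thesis by simp
qed

lemma nn_integral_lborel_swap:
  fixes f :: "'a::euclidean_space \<Rightarrow> 'b::euclidean_space \<Rightarrow> ennreal"
  assumes "case_prod f \<in> borel_measurable (lborel \<Otimes>\<^sub>M lborel)"
  shows "(\<integral>\<^sup>+ x. \<integral>\<^sup>+ y. f x y \<partial>lborel \<partial>lborel) = (\<integral>\<^sup>+ y. \<integral>\<^sup>+ x. f x y \<partial>lborel \<partial>lborel)"
  using lborel_pair.Fubini'[OF assms] by simp

lemma nn_integral_lborel_pair:
  fixes f :: "'a::euclidean_space \<times> 'b::euclidean_space \<Rightarrow> ennreal"
  assumes "f \<in> borel_measurable borel"
  shows "(\<integral>\<^sup>+ X. f X \<partial>lborel) = (\<integral>\<^sup>+ x. \<integral>\<^sup>+ y. f (x, y) \<partial>lborel \<partial>lborel)"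
  using lborel.nn_integral_fst[of f lborel] assms by (simp add: lborel_prod)

lemma borel_measurable_fst_snd [measurable (raw)]:
  fixes f :: "'c \<Rightarrow> 'a::euclidean_space \<times> 'b::euclidean_space"
  assumes "f \<in> borel_measurable L"
  shows "(\<lambda>x. fst (f x)) \<in> borel_measurable L" "(\<lambda>x. snd (f x)) \<in> borel_measurable L"
  by (rule measurable_compose[OF assms borel_measurable_continuous_onI], intro continuous_intros)+

lemma sets_ball_cylinder [measurable]:
  fixes x :: "'a::euclidean_space" and t :: real
  shows "ball x t \<in> sets borel" "ball x t \<times> {0<..<t} \<in> sets borel"
  by (rule borel_open, simp)(rule borel_open, intro open_Times, auto)

text \<open>
  Integrating the pointwise bound over \<open>A \<times> B\<close>; the first term does not see \<open>z\<close> and the last does not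
  see \<open>y\<close>, so each picks up the measure of the set it ignores.
\<close>

lemma average_chain:
  fixes w M :: ennreal and f :: "'b \<Rightarrow> ennreal" and h :: "'a \<Rightarrow> ennreal"
  assumes [measurable]: "A \<in> sets P" "B \<in> sets Q"
    "f \<in> borel_measurable Q" "h \<in> borel_measurable P"
    "case_prod g \<in> borel_measurable (P \<Otimes>\<^sub>M Q)"
    and "sigma_finite_measure Q"
    and le: "\<And>z y. z \<in> A \<Longrightarrow> y \<in> B \<Longrightarrow> w \<le> M * (f y + g z y + h z)"
  shows "emeasure P A * emeasure Q B * w
    \<le> M * (emeasure P A * (\<integral>\<^sup>+y\<in>B. f y \<partial>Q) + (\<integral>\<^sup>+z\<in>A. (\<integral>\<^sup>+y\<in>B. g z y \<partial>Q) \<partial>P)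
           + emeasure Q B * (\<integral>\<^sup>+z\<in>A. h z \<partial>P))"
proof -
  interpret Q: sigma_finite_measure Q by fact
  have "emeasure P A * emeasure Q B * w = (\<integral>\<^sup>+z\<in>A. (\<integral>\<^sup>+y\<in>B. w \<partial>Q) \<partial>P)"
    using nn_integral_multc[of "indicator A" P "w * emeasure Q B"]
    by (simp add: nn_integral_cmult_indicator mult_ac)
  also have "\<dots> \<le> (\<integral>\<^sup>+z\<in>A. (\<integral>\<^sup>+y\<in>B. M * (f y + g z y + h z) \<partial>Q) \<partial>P)"
    using le by (intro nn_integral_mono) (auto simp: indicator_def intro!: nn_integral_mono)
  also have "\<dots> = (\<integral>\<^sup>+z\<in>A. (M * ((\<integral>\<^sup>+y\<in>B. f y \<partial>Q) + (\<integral>\<^sup>+y\<in>B. g z y \<partial>Q) + h z * emeasure Q B)) \<partial>P)"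
  proof (intro nn_integral_cong arg_cong2[where f = "(*)"] refl)
    fix z assume [measurable]: "z \<in> space P"
    have "(\<integral>\<^sup>+y\<in>B. M * (f y + g z y + h z) \<partial>Q)
        = (\<integral>\<^sup>+y. M * (f y * indicator B y + g z y * indicator B y + h z * indicator B y) \<partial>Q)"
      by (intro nn_integral_cong) (auto simp: indicator_def)
    also have "\<dots> = M * ((\<integral>\<^sup>+y\<in>B. f y \<partial>Q) + (\<integral>\<^sup>+y\<in>B. g z y \<partial>Q) + h z * emeasure Q B)"
      by (simp add: nn_integral_cmult nn_integral_add)
    finally show "(\<integral>\<^sup>+y\<in>B. M * (f y + g z y + h z) \<partial>Q) = \<dots>" .
  qed
  also have "\<dots> = (\<integral>\<^sup>+z. (M * ((\<integral>\<^sup>+y\<in>B. f y \<partial>Q) * indicator A z + (\<integral>\<^sup>+y\<in>B. g z y \<partial>Q) * indicator A z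
        + emeasure Q B * (h z * indicator A z))) \<partial>P)"
    by (intro nn_integral_cong) (auto simp: indicator_def mult_ac)
  also have "\<dots> = M * (emeasure P A * (\<integral>\<^sup>+y\<in>B. f y \<partial>Q) + (\<integral>\<^sup>+z\<in>A. (\<integral>\<^sup>+y\<in>B. g z y \<partial>Q) \<partial>P)
           + emeasure Q B * (\<integral>\<^sup>+z\<in>A. h z \<partial>P))"
    using nn_integral_multc[of "indicator A" P "\<integral>\<^sup>+y\<in>B. f y \<partial>Q"]
    by (simp add: nn_integral_cmult nn_integral_add mult.commute)
  finally show ?thesis .
qed

lemma emeasure_cylinder:
  fixes x :: "'a::euclidean_space"
  assumes "0 < t"
  shows "emeasure lborel (ball x t \<times> {0<..<t})
    = ennreal (unit_ball_vol (real DIM('a)) * t ^ DIM('a)) * ennreal t"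
  using assms by (simp add: lborel_prod[symmetric] lborel.emeasure_pair_measure_Times emeasure_ball)

text \<open>
  The cylinder over \<open>ball x t\<close> has height \<open>t\<close>, so it is seen at scale \<open>t\<close> from all boundary points near
  \<open>x\<close>. With \<open>z = x\<close> this serves the first link of the chain, with \<open>z\<close> in \<open>ball x t\<close> the middle one.
\<close>

lemma dist_cylinder:
  fixes x z :: "'a::real_normed_vector" and y :: "'a \<times> real"
  assumes "dist x (fst y) < t" "0 < snd y" "snd y < t"
  shows "norm ((z, 0) - y) < dist x z + 2 * t"
proof -
  have "norm ((z, 0) - y) \<le> norm (z - fst y) + norm (snd y)"
    using norm_Pair_le[of "z - fst y" "- snd y"] by (cases y) auto
  also have "norm (z - fst y) \<le> dist x z + dist x (fst y)"
    using dist_triangle3[of z "fst y" x] by (simp add: dist_norm norm_minus_commute)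
  finally show ?thesis using assms by auto
qed

section \<open>The three links of the chain\<close>

text \<open>
  For \<open>G z y = \<bar>v z - u y\<bar> powr p\<close> and \<open>q = N + s p\<close> this is the double integral on the right of the
  inequality.
\<close>

definition boundary_energy :: "real \<Rightarrow> ('a::euclidean_space \<Rightarrow> 'a \<times> real \<Rightarrow> ennreal) \<Rightarrow> ennreal" where
  "boundary_energy q G =
    (\<integral>\<^sup>+ z. \<integral>\<^sup>+ y. of_bool (0 < snd y) * (ennreal (norm ((z, 0) - y) powr - q) * G z y) \<partial>lborel \<partial>lborel)"

context
  fixes G :: "'a::euclidean_space \<Rightarrow> 'a \<times> real \<Rightarrow> ennreal" and q c :: real
  assumes G: "(\<lambda>(z, y). G z y) \<in> borel_measurable borel"
    and q: "0 < q" and c: "c = unit_ball_vol (real DIM('a))"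
begin

lemma borel_measurable_kernel [measurable (raw)]:
  "f \<in> borel_measurable L \<Longrightarrow> g \<in> borel_measurable L \<Longrightarrow> (\<lambda>x. G (f x) (g x)) \<in> borel_measurable L"
  using measurable_compose[OF borel_measurable_Pair G, of f L g] by simp

lemma c_pos: "0 < c" by (simp add: c)

text \<open>
  The singular kernel is a superposition over scales: integrating the weight left by the averages over all scales
  \<open>t\<close> at which \<open>z\<close> and \<open>y\<close> may both appear, those larger than a fraction of their distance, gives back
  the power \<open>- q\<close> of that distance.
\<close>

lemma nn_integral_admissible_scales:
  fixes z :: 'a and y :: "'a \<times> real"
  assumes "0 < snd y" "0 < m"
  shows "(\<integral>\<^sup>+ t. of_bool (norm ((z, 0) - y) < m * t) * ennreal (t powr - (q + 1) / c) \<partial>lborel)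
    = ennreal (m powr q / (q * c)) * ennreal (norm ((z, 0) - y) powr - q)"
proof -
  define r where "r = norm ((z, 0) - y)"
  have "(z, 0) \<noteq> y" using assms(1) by (metis less_irrefl snd_conv)
  then have r: "0 < r" by (simp add: r_def)
  have "(\<integral>\<^sup>+ t. of_bool (r < m * t) * ennreal (t powr - (q + 1) / c) \<partial>lborel)
      = (\<integral>\<^sup>+ t. ennreal (1 / c) * (of_bool (r / m < t) * ennreal (t powr - (q + 1))) \<partial>lborel)"
    using assms c_pos
    by (intro nn_integral_cong) (auto simp: field_simps ennreal_mult'[symmetric])
  also have "\<dots> = ennreal (1 / c) * ennreal ((r / m) powr - q / q)"
    using assms r q nn_integral_powr_tail[of "r / m" q] by (subst nn_integral_cmult) auto
  also have "\<dots> = ennreal (m powr q / (q * c)) * ennreal (r powr - q)"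
    using assms r q c_pos
    by (simp add: ennreal_mult'[symmetric] powr_divide powr_minus field_simps)
  finally show ?thesis by (simp add: r_def)
qed

text \<open>
  The link from \<open>v x\<close> to \<open>u y\<close>. For fixed \<open>x\<close> and \<open>y\<close>, the scales at which \<open>y\<close> lies in the cylinder over
  \<open>ball x t\<close> all exceed half of the distance between the two points.
\<close>

lemma first_link_le_energy:
  "(\<integral>\<^sup>+ x. \<integral>\<^sup>+ t. of_bool (0 < t) * (ennreal (t powr - (q + 1) / c) *
      (\<integral>\<^sup>+ y\<in>ball x t \<times> {0<..<t}. G x y \<partial>lborel)) \<partial>lborel \<partial>lborel)
    \<le> ennreal (2 powr q / (q * c)) * boundary_energy q G"
proof -
  let ?K = "\<lambda>t. ennreal (t powr - (q + 1) / c)"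
  have "(\<integral>\<^sup>+ x. \<integral>\<^sup>+ t. of_bool (0 < t) * (?K t * (\<integral>\<^sup>+ y\<in>ball x t \<times> {0<..<t}. G x y \<partial>lborel)) \<partial>lborel \<partial>lborel)
     \<le> (\<integral>\<^sup>+ x. \<integral>\<^sup>+ t. \<integral>\<^sup>+ y. ?K t * (of_bool (0 < snd y) * of_bool (norm ((x, 0) - y) < 2 * t) * G x y) \<partial>lborel \<partial>lborel \<partial>lborel)"
  proof (intro nn_integral_mono)
    fix x :: 'a and t :: real
    have "G x y * indicator (ball x t \<times> {0<..<t}) y
        \<le> of_bool (0 < snd y) * of_bool (norm ((x, 0) - y) < 2 * t) * G x y" for y
      using dist_cylinder[of x y t x] by (auto simp: indicator_def)
    then have "(\<integral>\<^sup>+ y\<in>ball x t \<times> {0<..<t}. G x y \<partial>lborel)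
        \<le> (\<integral>\<^sup>+ y. of_bool (0 < snd y) * of_bool (norm ((x, 0) - y) < 2 * t) * G x y \<partial>lborel)"
      by (intro nn_integral_mono)
    moreover have "(\<lambda>y. of_bool (0 < snd y) * of_bool (norm ((x, 0) - y) < 2 * t) * G x y) \<in> borel_measurable lborel"
      by measurable
    ultimately show "of_bool (0 < t) * (?K t * (\<integral>\<^sup>+ y\<in>ball x t \<times> {0<..<t}. G x y \<partial>lborel))
      \<le> (\<integral>\<^sup>+ y. ?K t * (of_bool (0 < snd y) * of_bool (norm ((x, 0) - y) < 2 * t) * G x y) \<partial>lborel)"
      by (simp add: nn_integral_cmult mult_left_mono)
  qed
  also have "\<dots> = (\<integral>\<^sup>+ x. \<integral>\<^sup>+ y. \<integral>\<^sup>+ t. ?K t * (of_bool (0 < snd y) * of_bool (norm ((x, 0) - y) < 2 * t) * G x y) \<partial>lborel \<partial>lborel \<partial>lborel)"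
    by (intro nn_integral_cong nn_integral_lborel_swap) measurable
  also have "\<dots> = (\<integral>\<^sup>+ x. \<integral>\<^sup>+ y. ennreal (2 powr q / (q * c)) * (of_bool (0 < snd y) * (ennreal (norm ((x, 0) - y) powr - q) * G x y)) \<partial>lborel \<partial>lborel)"
  proof (intro nn_integral_cong)
    fix x y
    show "(\<integral>\<^sup>+ t. ?K t * (of_bool (0 < snd y) * of_bool (norm ((x, 0) - y) < 2 * t) * G x y) \<partial>lborel)
      = ennreal (2 powr q / (q * c)) * (of_bool (0 < snd y) * (ennreal (norm ((x, 0) - y) powr - q) * G x y))"
    proof (cases "0 < snd y")
      case True
      have "(\<integral>\<^sup>+ t. ?K t * (of_bool (0 < snd y) * of_bool (norm ((x, 0) - y) < 2 * t) * G x y) \<partial>lborel)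
         = (\<integral>\<^sup>+ t. of_bool (norm ((x, 0) - y) < 2 * t) * ?K t \<partial>lborel) * G x y"
        using True by (subst nn_integral_multc[symmetric]) (auto intro!: nn_integral_cong simp: mult_ac)
      then show ?thesis using True nn_integral_admissible_scales[OF True, of 2] by (simp add: mult_ac)
    qed simp
  qed
  also have "\<dots> = ennreal (2 powr q / (q * c)) * boundary_energy q G"
    unfolding boundary_energy_def by (simp add: nn_integral_cmult)
  finally show ?thesis .
qed

text \<open>
  The link from \<open>v z\<close> to \<open>u y\<close>, neither of which is the base point \<open>x\<close>. Integrating over the base points
  \<open>x\<close> in \<open>ball z t\<close> gains \<open>c * t ^ DIM('a)\<close>, which leaves the weight of the first link; the constraint
  on \<open>t\<close> that survives is that it exceeds a third of the distance between \<open>z\<close> and \<open>y\<close>.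
\<close>

lemma middle_link_le_energy:
  "(\<integral>\<^sup>+ x. \<integral>\<^sup>+ t. of_bool (0 < t) * (ennreal (t powr - (q + 1) / (c * (c * t ^ DIM('a)))) *
      (\<integral>\<^sup>+ z\<in>ball x t. (\<integral>\<^sup>+ y\<in>ball x t \<times> {0<..<t}. G z y \<partial>lborel) \<partial>lborel)) \<partial>lborel \<partial>lborel)
    \<le> ennreal (3 powr q / (q * c)) * boundary_energy q G"
proof -
  let ?K = "\<lambda>t. ennreal (t powr - (q + 1) / (c * (c * t ^ DIM('a))))"
  let ?F = "\<lambda>x t z y. of_bool (0 < t) * (?K t * (of_bool (dist z x < t) *
    (of_bool (0 < snd y) * (of_bool (norm ((z, 0) - y) < 3 * t) * G z y))))"
  have "(\<integral>\<^sup>+ x. \<integral>\<^sup>+ t. of_bool (0 < t) * (?K t *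
      (\<integral>\<^sup>+ z\<in>ball x t. (\<integral>\<^sup>+ y\<in>ball x t \<times> {0<..<t}. G z y \<partial>lborel) \<partial>lborel)) \<partial>lborel \<partial>lborel)
    \<le> (\<integral>\<^sup>+ x. \<integral>\<^sup>+ t. \<integral>\<^sup>+ z. \<integral>\<^sup>+ y. ?F x t z y \<partial>lborel \<partial>lborel \<partial>lborel \<partial>lborel)"
    proof (intro nn_integral_mono)
    fix x :: 'a and t :: real
    show "of_bool (0 < t) * (?K t *
        (\<integral>\<^sup>+ z\<in>ball x t. (\<integral>\<^sup>+ y\<in>ball x t \<times> {0<..<t}. G z y \<partial>lborel) \<partial>lborel))
      \<le> (\<integral>\<^sup>+ z. \<integral>\<^sup>+ y. ?F x t z y \<partial>lborel \<partial>lborel)"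
    proof (cases "0 < t")
      case True
      have "?K t * ((\<integral>\<^sup>+ y\<in>ball x t \<times> {0<..<t}. G z y \<partial>lborel) * indicator (ball x t) z)
          \<le> (\<integral>\<^sup>+ y. ?F x t z y \<partial>lborel)" for z
      proof (cases "z \<in> ball x t")
        case z: True
        have "?K t * (G z y * indicator (ball x t \<times> {0<..<t}) y) \<le> ?F x t z y" for y
          using z True dist_cylinder[of x y t z]
          by (auto simp: indicator_def dist_commute)
        then have "(\<integral>\<^sup>+ y. ?K t * (G z y * indicator (ball x t \<times> {0<..<t}) y) \<partial>lborel)
            \<le> (\<integral>\<^sup>+ y. ?F x t z y \<partial>lborel)"
          by (rule nn_integral_mono)
        then show ?thesis
          using z by (subst (asm) nn_integral_cmult) auto
      qed simp
      then have "(\<integral>\<^sup>+ z. ?K t * ((\<integral>\<^sup>+ y\<in>ball x t \<times> {0<..<t}. G z y \<partial>lborel) * indicator (ball x t) z) \<partial>lborel)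
          \<le> (\<integral>\<^sup>+ z. \<integral>\<^sup>+ y. ?F x t z y \<partial>lborel \<partial>lborel)"
        by (rule nn_integral_mono)
      then show ?thesis
        using True by (subst (asm) nn_integral_cmult) auto
    qed simp
  qed
  also have "\<dots> = (\<integral>\<^sup>+ z. \<integral>\<^sup>+ y. \<integral>\<^sup>+ t. \<integral>\<^sup>+ x. ?F x t z y \<partial>lborel \<partial>lborel \<partial>lborel \<partial>lborel)"
    proof -
    \<comment> \<open>Adjacent transpositions bring the order \<open>x, t, z, y\<close> into \<open>z, y, t, x\<close>.\<close>
    have "(\<integral>\<^sup>+ x. \<integral>\<^sup>+ t. \<integral>\<^sup>+ z. \<integral>\<^sup>+ y. ?F x t z y \<partial>lborel \<partial>lborel \<partial>lborel \<partial>lborel)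
      = (\<integral>\<^sup>+ x. \<integral>\<^sup>+ z. \<integral>\<^sup>+ t. \<integral>\<^sup>+ y. ?F x t z y \<partial>lborel \<partial>lborel \<partial>lborel \<partial>lborel)"
      by (intro nn_integral_cong nn_integral_lborel_swap) measurable
    also have "\<dots> = (\<integral>\<^sup>+ z. \<integral>\<^sup>+ x. \<integral>\<^sup>+ t. \<integral>\<^sup>+ y. ?F x t z y \<partial>lborel \<partial>lborel \<partial>lborel \<partial>lborel)"
      by (intro nn_integral_lborel_swap) measurable
    also have "\<dots> = (\<integral>\<^sup>+ z. \<integral>\<^sup>+ x. \<integral>\<^sup>+ y. \<integral>\<^sup>+ t. ?F x t z y \<partial>lborel \<partial>lborel \<partial>lborel \<partial>lborel)"
      by (intro nn_integral_cong nn_integral_lborel_swap) measurable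
    also have "\<dots> = (\<integral>\<^sup>+ z. \<integral>\<^sup>+ y. \<integral>\<^sup>+ x. \<integral>\<^sup>+ t. ?F x t z y \<partial>lborel \<partial>lborel \<partial>lborel \<partial>lborel)"
      by (intro nn_integral_cong nn_integral_lborel_swap) measurable
    also have "\<dots> = (\<integral>\<^sup>+ z. \<integral>\<^sup>+ y. \<integral>\<^sup>+ t. \<integral>\<^sup>+ x. ?F x t z y \<partial>lborel \<partial>lborel \<partial>lborel \<partial>lborel)"
      by (intro nn_integral_cong nn_integral_lborel_swap) measurable
    finally show ?thesis .
  qed
  also have "\<dots> = (\<integral>\<^sup>+ z. \<integral>\<^sup>+ y. ennreal (3 powr q / (q * c)) * (of_bool (0 < snd y) * (ennreal (norm ((z, 0) - y) powr - q) * G z y)) \<partial>lborel \<partial>lborel)"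
    proof (intro nn_integral_cong)
    fix z :: 'a and y :: "'a \<times> real"
    show "(\<integral>\<^sup>+ t. \<integral>\<^sup>+ x. ?F x t z y \<partial>lborel \<partial>lborel)
      = ennreal (3 powr q / (q * c)) * (of_bool (0 < snd y) * (ennreal (norm ((z, 0) - y) powr - q) * G z y))"
    proof (cases "0 < snd y")
      case True
      have inner: "(\<integral>\<^sup>+ x. ?F x t z y \<partial>lborel)
        = of_bool (norm ((z, 0) - y) < 3 * t) * ennreal (t powr - (q + 1) / c) * G z y" for t
      proof (cases "norm ((z, 0) - y) < 3 * t")
        case less: True
        then have t: "0 < t" by (smt (verit) norm_ge_zero)
        have "(\<integral>\<^sup>+ x. ?F x t z y \<partial>lborel) = (\<integral>\<^sup>+ x. (?K t * G z y) * indicator (ball z t) x \<partial>lborel)"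
          using True less t by (intro nn_integral_cong) (auto simp: indicator_def)
        also have "\<dots> = ?K t * ennreal (c * t ^ DIM('a)) * G z y"
          using t by (subst nn_integral_cmult_indicator) (auto simp: emeasure_ball c mult_ac)
        also have "?K t * ennreal (c * t ^ DIM('a)) = ennreal (t powr - (q + 1) / c)"
          using t c_pos by (simp add: ennreal_mult[symmetric])
        finally show ?thesis using less by simp
      qed simp
      have "(\<integral>\<^sup>+ t. \<integral>\<^sup>+ x. ?F x t z y \<partial>lborel \<partial>lborel)
        = (\<integral>\<^sup>+ t. of_bool (norm ((z, 0) - y) < 3 * t) * ennreal (t powr - (q + 1) / c) \<partial>lborel) * G z y"
        unfolding inner by (rule nn_integral_multc) measurable
      then show ?thesis using True nn_integral_admissible_scales[OF True, of 3] by (simp add: mult_ac)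
    qed simp
  qed
  also have "\<dots> = ennreal (3 powr q / (q * c)) * boundary_energy q G"
    unfolding boundary_energy_def by (simp add: nn_integral_cmult)
  finally show ?thesis .
qed


text \<open>
  The link from \<open>v z\<close> to \<open>u (x, t)\<close>. Here the scale is a coordinate of the interior point and is kept;
  the weight is bounded pointwise, because that point is within \<open>2 * t\<close> of \<open>(z, 0)\<close>.
\<close>

lemma last_link_le_energy:
  "(\<integral>\<^sup>+ x. \<integral>\<^sup>+ t. of_bool (0 < t) * (ennreal (t powr - q / c) *
      (\<integral>\<^sup>+ z\<in>ball x t. G z (x, t) \<partial>lborel)) \<partial>lborel \<partial>lborel)
    \<le> ennreal (2 powr q / c) * boundary_energy q G"
proof -
  have "(\<integral>\<^sup>+ x. \<integral>\<^sup>+ t. of_bool (0 < t) * (ennreal (t powr - q / c) *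
      (\<integral>\<^sup>+ z\<in>ball x t. G z (x, t) \<partial>lborel)) \<partial>lborel \<partial>lborel)
    \<le> (\<integral>\<^sup>+ x. \<integral>\<^sup>+ t. \<integral>\<^sup>+ z. ennreal (2 powr q / c) * (of_bool (0 < t) *
         (ennreal (norm ((z, 0) - (x, t)) powr - q) * G z (x, t))) \<partial>lborel \<partial>lborel \<partial>lborel)"
  proof (intro nn_integral_mono)
    fix x :: 'a and t :: real
    have K: "ennreal (t powr - q / c) * (G z (x, t) * indicator (ball x t) z)
      \<le> ennreal (2 powr q / c) * (ennreal (norm ((z, 0) - (x, t)) powr - q) * G z (x, t))"
      if "0 < t" for z
    proof (cases "z \<in> ball x t")
      case True
      let ?r = "norm ((z, 0) - (x, t))"
      have r: "0 < ?r" using that by (auto simp: zero_prod_def)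
      have "?r \<le> norm (z - x) + norm t"
        using norm_Pair_le[of "z - x" "- t"] by simp
      also have "\<dots> < 2 * t"
        using True that by (simp add: dist_norm norm_minus_commute)
      finally have "?r powr q \<le> (2 * t) powr q"
        using r q by (intro powr_mono2) auto
      then have "t powr - q \<le> 2 powr q * ?r powr - q"
        using r that by (simp add: powr_minus powr_mult field_simps)
      then have "t powr - q / c \<le> 2 powr q / c * ?r powr - q"
        using c_pos by (simp add: field_simps)
      then have "ennreal (t powr - q / c) \<le> ennreal (2 powr q / c) * ennreal (?r powr - q)"
        using c_pos by (subst ennreal_mult[symmetric]) (auto intro!: ennreal_leI)
      then show ?thesis using True by (simp add: mult.assoc[symmetric] mult_right_mono)
    qed simp
    show "of_bool (0 < t) * (ennreal (t powr - q / c) * (\<integral>\<^sup>+ z\<in>ball x t. G z (x, t) \<partial>lborel))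
      \<le> (\<integral>\<^sup>+ z. ennreal (2 powr q / c) * (of_bool (0 < t) *
         (ennreal (norm ((z, 0) - (x, t)) powr - q) * G z (x, t))) \<partial>lborel)"
    proof (cases "0 < t")
      case True
      then show ?thesis
        by (subst nn_integral_cmult[symmetric]) (use K in \<open>auto intro!: nn_integral_mono\<close>)
    qed simp
  qed
  also have "\<dots> = (\<integral>\<^sup>+ X. \<integral>\<^sup>+ z. ennreal (2 powr q / c) * (of_bool (0 < snd X) *
         (ennreal (norm ((z, 0) - X) powr - q) * G z X)) \<partial>lborel \<partial>lborel)"
    by (subst nn_integral_lborel_pair) auto
  also have "\<dots> = (\<integral>\<^sup>+ z. \<integral>\<^sup>+ X. ennreal (2 powr q / c) * (of_bool (0 < snd X) *
         (ennreal (norm ((z, 0) - X) powr - q) * G z X)) \<partial>lborel \<partial>lborel)"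
    by (rule nn_integral_lborel_swap) measurable
  also have "\<dots> = ennreal (2 powr q / c) * boundary_energy q G"
    unfolding boundary_energy_def by (simp add: nn_integral_cmult)
  finally show ?thesis .
qed

section \<open>The trace inequality\<close>

text \<open>
  The averaged chain at one point. Multiplying by \<open>\<kappa>\<close> divides by the measures \<open>\<alpha>\<close> of the ball and \<open>\<beta>\<close>
  of the cylinder and brings in the weight; the three coefficients are what remains of it for each link.
\<close>

lemma pointwise_average:
  fixes M :: ennreal and x :: 'a
  assumes t: "0 < t"
    and quasi: "\<And>x z y X. G x X \<le> M * (G x y + G z y + G z X)"
  shows "ennreal (t powr (DIM('a) - q)) * G x (x, t)
    \<le> M * (ennreal (t powr - (q + 1) / c) * (\<integral>\<^sup>+ y\<in>ball x t \<times> {0<..<t}. G x y \<partial>lborel)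
      + ennreal (t powr - (q + 1) / (c * (c * t ^ DIM('a)))) *
          (\<integral>\<^sup>+ z\<in>ball x t. (\<integral>\<^sup>+ y\<in>ball x t \<times> {0<..<t}. G z y \<partial>lborel) \<partial>lborel)
      + ennreal (t powr - q / c) * (\<integral>\<^sup>+ z\<in>ball x t. G z (x, t) \<partial>lborel))"
    (is "_ \<le> M * (?k1 * ?I1 + ?k2 * ?I2 + ?k3 * ?I3)")
proof -
  define \<alpha> \<beta> \<kappa> where "\<alpha> = c * t ^ DIM('a)" and "\<beta> = c * t ^ DIM('a) * t"
    and "\<kappa> = t powr (DIM('a) - q) / (\<alpha> * \<beta>)"
  have pos: "0 < \<alpha>" "0 < \<beta>" "0 \<le> \<kappa>" using t c_pos by (auto simp: \<alpha>_def \<beta>_def \<kappa>_def)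
  have A: "emeasure lborel (ball x t) = ennreal \<alpha>"
    using t by (simp add: emeasure_ball \<alpha>_def c)
  have B: "emeasure lborel (ball x t \<times> {0<..<t}) = ennreal \<beta>"
    using t c_pos emeasure_cylinder[of t x] by (simp add: \<beta>_def c ennreal_mult)
  have "ennreal \<alpha> * ennreal \<beta> * G x (x, t)
      \<le> M * (ennreal \<alpha> * ?I1 + ?I2 + ennreal \<beta> * ?I3)"
    unfolding A[symmetric] B[symmetric]
    by (rule average_chain)
       (auto intro: quasi lborel.sigma_finite_measure_axioms)
  then have "ennreal \<kappa> * (ennreal \<alpha> * ennreal \<beta> * G x (x, t))
      \<le> ennreal \<kappa> * (M * (ennreal \<alpha> * ?I1 + ?I2 + ennreal \<beta> * ?I3))"
    by (rule mult_left_mono) simp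
  then have *: "ennreal (\<kappa> * \<alpha> * \<beta>) * G x (x, t)
      \<le> M * (ennreal (\<kappa> * \<alpha>) * ?I1 + ennreal \<kappa> * ?I2 + ennreal (\<kappa> * \<beta>) * ?I3)"
    using pos by (simp add: ennreal_mult distrib_left mult_ac)
  \<comment> \<open>With the integer powers split off, the identities below are cancellations of powers of \<open>t\<close>.\<close>
  have e: "t powr (DIM('a) - q) = t ^ DIM('a) * t powr - q" "t powr - (q + 1) = t powr - q / t"
    using t by (simp_all add: powr_diff powr_minus powr_add powr_realpow field_simps)
  have "\<kappa> * \<alpha> * \<beta> = t powr (DIM('a) - q)" "\<kappa> * \<alpha> = t powr - (q + 1) / c"
    "\<kappa> = t powr - (q + 1) / (c * (c * t ^ DIM('a)))" "\<kappa> * \<beta> = t powr - q / c"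
    using t c_pos unfolding \<kappa>_def \<alpha>_def \<beta>_def e by (simp_all add: field_simps)
  with * show ?thesis by simp
qed

text \<open>
  The coefficients of the averaged chain are those of the three link bounds, so the constant is the
  quasi-triangle constant \<open>M\<close> times the sum of the constants of the links.
\<close>

lemma weighted_trace_inequality:
  fixes M :: ennreal
  assumes quasi: "\<And>x z y X. G x X \<le> M * (G x y + G z y + G z X)"
  shows "(\<integral>\<^sup>+ X. of_bool (0 < snd X) * (ennreal (snd X powr (DIM('a) - q)) * G (fst X) X) \<partial>lborel)
    \<le> M * ennreal ((2 powr q / q + 3 powr q / q + 2 powr q) / c) * boundary_energy q G"
proof -
  let ?T1 = "\<lambda>x t. of_bool (0 < t) * (ennreal (t powr - (q + 1) / c) *
      (\<integral>\<^sup>+ y\<in>ball x t \<times> {0<..<t}. G x y \<partial>lborel))"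
  let ?T2 = "\<lambda>x t. of_bool (0 < t) * (ennreal (t powr - (q + 1) / (c * (c * t ^ DIM('a)))) *
      (\<integral>\<^sup>+ z\<in>ball x t. (\<integral>\<^sup>+ y\<in>ball x t \<times> {0<..<t}. G z y \<partial>lborel) \<partial>lborel))"
  let ?T3 = "\<lambda>x t. of_bool (0 < t) * (ennreal (t powr - q / c) *
      (\<integral>\<^sup>+ z\<in>ball x t. G z (x, t) \<partial>lborel))"
  have split_sum: "(\<integral>\<^sup>+ x. \<integral>\<^sup>+ t. M * (f x t + g x t + h x t) \<partial>lborel \<partial>lborel)
      = M * ((\<integral>\<^sup>+ x. \<integral>\<^sup>+ t. f x t \<partial>lborel \<partial>lborel) + (\<integral>\<^sup>+ x. \<integral>\<^sup>+ t. g x t \<partial>lborel \<partial>lborel)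
        + (\<integral>\<^sup>+ x. \<integral>\<^sup>+ t. h x t \<partial>lborel \<partial>lborel))"
    if [measurable]: "case_prod f \<in> borel_measurable (lborel \<Otimes>\<^sub>M lborel)"
      "case_prod g \<in> borel_measurable (lborel \<Otimes>\<^sub>M lborel)"
      "case_prod h \<in> borel_measurable (lborel \<Otimes>\<^sub>M lborel)"
    for f g h :: "'a \<Rightarrow> real \<Rightarrow> ennreal"
    by (simp add: nn_integral_cmult nn_integral_add)
  \<comment> \<open>The sets of integration vary with the outer variables; as conditions on all variables jointly
    their indicators become measurable on the product.\<close>
  have ind: "indicator (ball x t) z = (of_bool (dist x z < t) :: ennreal)"
    "indicator (ball x t \<times> {0<..<t}) y =
      (of_bool (dist x (fst y) < t) * (of_bool (0 < snd y) * of_bool (snd y < t)) :: ennreal)"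
    for x z :: 'a and t and y :: "'a \<times> real"
    by (auto simp: indicator_def mem_Times_iff)
  have [measurable]:
    "(\<lambda>(x, t). \<integral>\<^sup>+ y\<in>ball x t \<times> {0<..<t}. G x y \<partial>lborel) \<in> borel_measurable (lborel \<Otimes>\<^sub>M lborel)"
    "(\<lambda>(x, t). \<integral>\<^sup>+ z\<in>ball x t. (\<integral>\<^sup>+ y\<in>ball x t \<times> {0<..<t}. G z y \<partial>lborel) \<partial>lborel)
      \<in> borel_measurable (lborel \<Otimes>\<^sub>M lborel)"
    "(\<lambda>(x, t). \<integral>\<^sup>+ z\<in>ball x t. G z (x, t) \<partial>lborel) \<in> borel_measurable (lborel \<Otimes>\<^sub>M lborel)"
    unfolding ind by measurable
  have T: "case_prod ?T1 \<in> borel_measurable (lborel \<Otimes>\<^sub>M lborel)"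
    "case_prod ?T2 \<in> borel_measurable (lborel \<Otimes>\<^sub>M lborel)"
    "case_prod ?T3 \<in> borel_measurable (lborel \<Otimes>\<^sub>M lborel)"
    by measurable
  have "(\<integral>\<^sup>+ X. of_bool (0 < snd X) * (ennreal (snd X powr (DIM('a) - q)) * G (fst X) X) \<partial>lborel)
    = (\<integral>\<^sup>+ x. \<integral>\<^sup>+ t. of_bool (0 < t) * (ennreal (t powr (DIM('a) - q)) * G x (x, t)) \<partial>lborel \<partial>lborel)"
    by (subst nn_integral_lborel_pair) auto
  also have "\<dots> \<le> (\<integral>\<^sup>+ x. \<integral>\<^sup>+ t. M * (?T1 x t + ?T2 x t + ?T3 x t) \<partial>lborel \<partial>lborel)"
  proof (intro nn_integral_mono)
    fix x :: 'a and t :: real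
    show "of_bool (0 < t) * (ennreal (t powr (DIM('a) - q)) * G x (x, t)) \<le> M * (?T1 x t + ?T2 x t + ?T3 x t)"
      using pointwise_average[of t M x] quasi by (cases "0 < t") auto
  qed
  also have "\<dots> = M * ((\<integral>\<^sup>+ x. \<integral>\<^sup>+ t. ?T1 x t \<partial>lborel \<partial>lborel) + (\<integral>\<^sup>+ x. \<integral>\<^sup>+ t. ?T2 x t \<partial>lborel \<partial>lborel)
      + (\<integral>\<^sup>+ x. \<integral>\<^sup>+ t. ?T3 x t \<partial>lborel \<partial>lborel))"
    by (rule split_sum[OF T])
  also have "\<dots> \<le> M * (ennreal (2 powr q / (q * c)) * boundary_energy q G + ennreal (3 powr q / (q * c)) * boundary_energy q G
      + ennreal (2 powr q / c) * boundary_energy q G)"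
    by (intro mult_left_mono add_mono first_link_le_energy middle_link_le_energy last_link_le_energy) simp
  also have "\<dots> = M * ennreal (2 powr q / (q * c) + 3 powr q / (q * c) + 2 powr q / c) * boundary_energy q G"
    using q c_pos by (simp add: distrib_right ennreal_plus[symmetric] mult.assoc del: ennreal_plus flip: distrib_right)
  also have "2 powr q / (q * c) + 3 powr q / (q * c) + 2 powr q / c = (2 powr q / q + 3 powr q / q + 2 powr q) / c"
    by (simp add: add_divide_distrib)
  finally show ?thesis .
qed

end

section \<open>The inequality for functions\<close>

lemma powr_abs_diff_chain:
  fixes a b c d p :: real
  assumes "0 \<le> p"
  shows "\<bar>a - d\<bar> powr p \<le> 3 powr p * (\<bar>a - b\<bar> powr p + \<bar>c - b\<bar> powr p + \<bar>c - d\<bar> powr p)"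
proof -
  \<comment> \<open>The longest link is at least a third of the whole distance.\<close>
  define m where "m = max \<bar>a - b\<bar> (max \<bar>c - b\<bar> \<bar>c - d\<bar>)"
  have "\<bar>a - d\<bar> powr p \<le> (3 * m) powr p"
    by (rule powr_mono2) (use assms in \<open>auto simp: m_def max_def abs_if split: if_splits\<close>)
  also have "\<dots> = 3 powr p * m powr p"
    by (rule powr_mult)
  also have "m powr p \<le> \<bar>a - b\<bar> powr p + \<bar>c - b\<bar> powr p + \<bar>c - d\<bar> powr p"
    by (auto simp: m_def max_def)
  finally show ?thesis by simp
qed

lemma borel_trace_inequality:
  fixes u :: "'a::euclidean_space \<times> real \<Rightarrow> real" and v :: "'a \<Rightarrow> real" and p q :: real
  assumes [measurable]: "u \<in> borel_measurable borel" "v \<in> borel_measurable borel"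
    and p: "0 \<le> p" and q: "0 < q"
  shows "(\<integral>\<^sup>+ x\<in>{x. 0 < snd x}. ennreal (\<bar>v (fst x) - u x\<bar> powr p / snd x powr (q - DIM('a))) \<partial>lborel)
    \<le> ennreal (3 powr p * ((2 powr q / q + 3 powr q / q + 2 powr q) / unit_ball_vol DIM('a))) *
      (\<integral>\<^sup>+ x. (\<integral>\<^sup>+ y\<in>{y. 0 < snd y}. ennreal (\<bar>v x - u y\<bar> powr p / norm ((x, 0) - y) powr q) \<partial>lborel) \<partial>lborel)"
proof -
  let ?G = "\<lambda>z y. ennreal (\<bar>v z - u y\<bar> powr p)"
  have G: "(\<lambda>(z, y). ?G z y) \<in> borel_measurable borel"
    unfolding case_prod_beta by measurable
  have quasi: "?G x X \<le> ennreal (3 powr p) * (?G x y + ?G z y + ?G z X)" for x z y X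
    using powr_abs_diff_chain[OF p] by (simp add: ennreal_mult'[symmetric] ennreal_plus[symmetric] ennreal_leI del: ennreal_plus)
  have 1: "(\<integral>\<^sup>+ x\<in>{x. 0 < snd x}. ennreal (\<bar>v (fst x) - u x\<bar> powr p / snd x powr (q - DIM('a))) \<partial>lborel)
    = (\<integral>\<^sup>+ X. of_bool (0 < snd X) * (ennreal (snd X powr (DIM('a) - q)) * ?G (fst X) X) \<partial>lborel)"
    by (intro nn_integral_cong)
       (auto simp: indicator_def ennreal_mult'[symmetric] powr_diff field_simps)
  have 2: "(\<integral>\<^sup>+ x. (\<integral>\<^sup>+ y\<in>{y. 0 < snd y}. ennreal (\<bar>v x - u y\<bar> powr p / norm ((x, 0) - y) powr q) \<partial>lborel) \<partial>lborel)
    = boundary_energy q ?G"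
    unfolding boundary_energy_def
    by (intro nn_integral_cong)
       (auto simp: indicator_def ennreal_mult'[symmetric] powr_minus field_simps)
  show ?thesis
    unfolding 1 2 ennreal_mult'[OF powr_ge_zero]
    by (rule weighted_trace_inequality[OF G q refl quasi])
qed

lemma open_half_space: "open half_space"
  unfolding half_space_def by (intro open_Collect_less continuous_intros)

lemma sets_half_space: "half_space \<in> sets lebesgue"
  by (rule sets_completionI_sets) (use borel_open[OF open_half_space] in simp)

lemma nn_integral_lebesgue_on_half_space:
  fixes f :: "(real^'n) \<times> real \<Rightarrow> ennreal"
  shows "(\<integral>\<^sup>+ x. f x \<partial>lebesgue_on half_space) = (\<integral>\<^sup>+ x\<in>{x. 0 < snd x}. f x \<partial>lborel)"
  using sets_half_space
  by (simp add: nn_integral_restrict_space nn_integral_completion half_space_def)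

theorem theorem6p1:
  fixes N :: nat and s p :: real
  assumes N: "N = CARD('n::finite) + 1"
    and s: "0 < s" "s < 1"
    and p: "1 \<le> p"
  shows "\<exists>C::real. 0 < C \<and>
    (\<forall>(u :: (real^'n) \<times> real \<Rightarrow> real) (v :: real^'n \<Rightarrow> real).
      u \<in> borel_measurable (lebesgue_on half_space) \<longrightarrow>
      v \<in> borel_measurable lebesgue \<longrightarrow>
      (\<integral>\<^sup>+ x. ennreal (\<bar>v (fst x) - u x\<bar> powr p / snd x powr (s * p + 1))
          \<partial>lebesgue_on half_space)
      \<le> ennreal C *
        (\<integral>\<^sup>+ x.
          (\<integral>\<^sup>+ y. ennreal (\<bar>v x - u y\<bar> powr p / norm (bdry_point x - y) powr (real N + s * p))
            \<partial>lebesgue_on half_space)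
        \<partial>lebesgue))"
proof -
  define q where "q = real N + s * p"
  have q: "0 < q" "q - real DIM(real^'n) = s * p + 1" using s p N by (simp_all add: q_def add_pos_nonneg)
  define C where "C = 3 powr p * ((2 powr q / q + 3 powr q / q + 2 powr q) / unit_ball_vol DIM(real^'n))"
  have "0 < C"
    unfolding C_def using q(1) by (intro mult_pos_pos divide_pos_pos add_pos_pos) simp_all
  moreover have "(\<integral>\<^sup>+ x. ennreal (\<bar>v (fst x) - u x\<bar> powr p / snd x powr (s * p + 1)) \<partial>lebesgue_on half_space)
      \<le> ennreal C * (\<integral>\<^sup>+ x. (\<integral>\<^sup>+ y. ennreal (\<bar>v x - u y\<bar> powr p / norm (bdry_point x - y) powr q)
            \<partial>lebesgue_on half_space) \<partial>lebesgue)"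
    if u: "u \<in> borel_measurable (lebesgue_on half_space)" and v: "v \<in> borel_measurable lebesgue"
    for u :: "(real^'n) \<times> real \<Rightarrow> real" and v
  proof -
    let ?H = "{x::(real^'n) \<times> real. 0 < snd x}"
    \<comment> \<open>Extending \<open>u\<close> by zero makes it measurable on the whole space, where it has a Borel version.\<close>
    have "(\<lambda>x. if x \<in> half_space then u x else 0) \<in> borel_measurable lebesgue"
      using u sets_half_space by (intro borel_measurable_if_I) auto
    then obtain u' where u' [measurable]: "u' \<in> borel_measurable borel"
      and "AE x in lborel. (if x \<in> half_space then u x else 0) = u' x"
      using completion_ex_borel_measurable_real by fastforce
    then have uu': "AE x in lborel. x \<in> ?H \<longrightarrow> u x = u' x"
      by (auto simp: half_space_def elim: eventually_mono)
    obtain v' where v' [measurable]: "v' \<in> borel_measurable borel" and vv': "AE x in lborel. v x = v' x"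
      using completion_ex_borel_measurable_real[OF v] by auto
    \<comment> \<open>The exceptional set of \<open>v\<close> times a line is null in the product space.\<close>
    have "AE x in (lborel :: ((real^'n) \<times> real) measure). v (fst x) = v' (fst x)"
    proof -
      obtain Z where Z: "Z \<in> null_sets lborel" "{x. v x \<noteq> v' x} \<subseteq> Z"
        using vv' by (auto simp: eventually_ae_filter)
      then have "Z \<times> (UNIV :: real set) \<in> null_sets (lborel \<Otimes>\<^sub>M lborel)"
        by (intro lborel.times_in_null_sets1) auto
      then show ?thesis
        using Z(2) unfolding lborel_prod by (intro AE_I') auto
    qed
    then have "(\<integral>\<^sup>+ x\<in>?H. ennreal (\<bar>v (fst x) - u x\<bar> powr p / snd x powr (s * p + 1)) \<partial>lborel)
      = (\<integral>\<^sup>+ x\<in>?H. ennreal (\<bar>v' (fst x) - u' x\<bar> powr p / snd x powr (s * p + 1)) \<partial>lborel)"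
      using uu' by (intro nn_integral_cong_AE) (auto simp: indicator_def elim!: eventually_elim2)
    moreover have "(\<integral>\<^sup>+ x. (\<integral>\<^sup>+ y\<in>?H. ennreal (\<bar>v x - u y\<bar> powr p / norm ((x, 0) - y) powr q) \<partial>lborel) \<partial>lborel)
      = (\<integral>\<^sup>+ x. (\<integral>\<^sup>+ y\<in>?H. ennreal (\<bar>v' x - u' y\<bar> powr p / norm ((x, 0) - y) powr q) \<partial>lborel) \<partial>lborel)"
      using vv'
    proof (intro nn_integral_cong_AE, elim eventually_mono)
      fix x assume "v x = v' x"
      then show "(\<integral>\<^sup>+ y\<in>?H. ennreal (\<bar>v x - u y\<bar> powr p / norm ((x, 0) - y) powr q) \<partial>lborel)
        = (\<integral>\<^sup>+ y\<in>?H. ennreal (\<bar>v' x - u' y\<bar> powr p / norm ((x, 0) - y) powr q) \<partial>lborel)"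
        using uu' by (intro nn_integral_cong_AE) (auto simp: indicator_def elim!: eventually_mono)
    qed
    ultimately show ?thesis
      using borel_trace_inequality[OF u' v', of p q] p q
      by (simp add: nn_integral_lebesgue_on_half_space nn_integral_completion bdry_point_def C_def)
  qed
  ultimately show ?thesis unfolding q_def by blast
qed

end
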